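(* Let $a>0$, $\rho<1$ be real numbers with $a\ge\rho$, let $N\in\{1,2,3,\dots\}\cup\{\infty\}$, and let $\pi=(\pi_k)$ be a probability law with $\pi_k>0$ for every $k$ in its support $\{0,1,\dots,N\}$ (read as $\{0,1,2,\dots\}$ if $N=\infty$), whose birth rates are affine: $b_k=a+\rho k$ for all $k$ in the support, where $b_k\pi_k=(k+1)\pi_{k+1}$ (and $b_N=0$ if $N<\infty$). For $j\ge1$ in the support let $$H_j:=\frac{F_{j-1}Q_j}{j\,\pi_j},\qquad F_{j-1}:=\sum_{i=0}^{j-1}\pi_i,\qquad Q_j:=\sum_{i=j}^{N}\pi_i .$$ Let $k\ge1$ be a maximizing index of $j\mapsto H_j$ (over all $j\ge 1$ in the support) for which $b_k>0$. (a) If $a>\rho$, then $$H_k\le\frac1{\sqrt{2(a-\rho)}} .$$ (b) More precisely (for all $a\ge\rho$), $$H_k\le\left[2(a-\rho)+\bigl\{(1-\rho)k-(a-\rho)\bigr\}^2+\left\{\frac{a-\rho+2\rho k}{a-\rho+(1+\rho)k}\right\}^2\right]^{-1/2}.$$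
   Context: The birth rates of a law $\pi$ with support $\{0,\dots,N\}$ in the unit-death normalization are the numbers $b_k\ge 0$ defined by detailed balance $b_k\pi_k=(k+1)\pi_{k+1}$, with $b_N=0$ if $N<\infty$. The quantity $H_k$ is the pointwise envelope $\sup_A|g_A(k)|$ of the solutions $g_A$ (with $g_A(0)=0$) of the Stein equation $b_kg_A(k+1)-kg_A(k)=\mathbf 1_A(k)-\pi(A)$, $A\subseteq\operatorname{supp}(\pi)$. *)

theory Defs
  imports "HOL-Probability.Probability_Mass_Function" "HOL-Library.Extended_Nat"
begin

text \<open>
  Unit-death normalization: on the support this is the unique solution of the
  detailed balance equation, see \<open>detailed_balance\<close> and \<open>birth_rate_unique\<close>; at the top
  point of a finite support it is \<open>0\<close>, see \<open>birth_rate_top\<close>.  Off the support the value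
  is the junk value of a division by zero.
\<close>

definition birth_rate :: "nat pmf \<Rightarrow> nat \<Rightarrow> real" where
  "birth_rate p k = real (k + 1) * pmf p (k + 1) / pmf p k"

lemma detailed_balance:
  assumes "k \<in> set_pmf p"
  shows "birth_rate p k * pmf p k = real (k + 1) * pmf p (k + 1)"
  using assms by (simp add: birth_rate_def set_pmf_iff)

lemma birth_rate_unique:
  assumes "k \<in> set_pmf p" and "b * pmf p k = real (k + 1) * pmf p (k + 1)"
  shows "b = birth_rate p k"
  using assms by (simp add: birth_rate_def set_pmf_iff field_simps)

lemma birth_rate_top:
  assumes "set_pmf p = {k. enat k \<le> enat n}"
  shows "birth_rate p n = 0"
  using assms by (simp add: birth_rate_def set_pmf_iff[symmetric] pmf_eq_0_set_pmf)

text \<open>\<open>lower_sum p j\<close> is $F_{j-1}$: the index is shifted by one.\<close>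

definition lower_sum :: "nat pmf \<Rightarrow> nat \<Rightarrow> real" where
  "lower_sum p j = (\<Sum>i<j. pmf p i)"

definition upper_sum :: "nat pmf \<Rightarrow> nat \<Rightarrow> real" where
  "upper_sum p j = (\<Sum>\<^sub>\<infinity>i\<in>{i \<in> set_pmf p. j \<le> i}. pmf p i)"

definition H :: "nat pmf \<Rightarrow> nat \<Rightarrow> real" where
  "H p j = lower_sum p j * upper_sum p j / (real j * pmf p j)"

end

theory Submission
  imports Defs
begin

text \<open>
  Put \<open>x = F / \<pi>\<^sub>k\<close>, \<open>y = Q / \<pi>\<^sub>k\<close>, \<open>w = k / (x y)\<close>, \<open>e = w (y - x)\<close> and \<open>c = b\<^bsub>k-1\<^esub>\<close>. Then
  \<open>1 / H\<^sub>k\<^sup>2 = e\<^sup>2 + 4 k w\<close>, while the comparisons of \<open>H\<^sub>k\<close> with its two neighbours are linear in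
  \<open>(e, w)\<close>: they read \<open>e \<le> c - k + \<rho> + w\<close> and \<open>e \<ge> c - k + 1 - w k / c\<close>. The convex function
  \<open>e\<^sup>2 + 4 k w\<close> is minimal on this wedge at its vertex, where its value is exactly the bracket
  in (b).
\<close>

lemma convex_min_at_vertex:
  fixes c \<rho> k e w :: real
  assumes c: "c > 0" and k: "k \<ge> 1" and \<rho>: "\<rho> < 1" and b: "c + \<rho> > 0"
    and up: "e \<le> c - k + \<rho> + w"
    and down: "e \<ge> c - k + 1 - w * k / c"
  shows "2 * (c - \<rho> * k) + (k - c)\<^sup>2 + ((c + \<rho> * k) / (c + k))\<^sup>2 \<le> e\<^sup>2 + 4 * k * w"
proof -
  \<comment> \<open>\<open>(e0, w0)\<close> is the vertex, where both constraints are equalities;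
    \<open>t\<close> is the common value there of \<open>\<rho> + w\<close> and
    \<open>1 - w * k / c\<close>.\<close>
  define t where "t = (c + \<rho> * k) / (c + k)"
  define e0 where "e0 = c - k + t"
  define w0 where "w0 = t - \<rho>"
  have ck: "c + k > 0" using c k by simp
  have tck: "t * (c + k) = c + \<rho> * k" using ck by (simp add: t_def)
  \<comment> \<open>Since \<open>2 * k + e0 = c + k + t\<close>, its sign is read off after
    multiplying by \<open>c + k\<close>. A negative \<open>\<rho>\<close> is absorbed into
    \<open>(c + \<rho>) * k\<close>.\<close>
  have "0 \<le> (c + k)\<^sup>2 + (c + \<rho> * k)"
  proof -
    have "(c + k)\<^sup>2 + (c + \<rho> * k) = c * c + k * k + c * k + (c + \<rho>) * k + c"
      by (simp add: power2_eq_square algebra_simps)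
    moreover have "(c + \<rho>) * k \<ge> 0" "c * k \<ge> 0" using b c k by simp_all
    then have "c * c + k * k + c * k + (c + \<rho>) * k + c \<ge> 0"
      using c by (intro add_nonneg_nonneg) simp_all
    ultimately show ?thesis by simp
  qed
  then have "0 \<le> (c + k) * (c + k + t)"
    using tck by (simp add: power2_eq_square algebra_simps)
  then have e0_lower: "0 \<le> 2 * k + e0"
    using ck by (simp add: e0_def zero_le_mult_iff)
  \<comment> \<open>Here \<open>t \<le> 1 \<le> c + k\<close>, from \<open>\<rho> < 1\<close> and
    \<open>k \<ge> 1\<close>.\<close>
  have "c + \<rho> * k \<le> c + k" using \<rho> k by simp
  also have "\<dots> \<le> (c + k) * (c + k)"
    using mult_left_mono[of 1 "c + k" "c + k"] c k by simp
  finally have "t \<le> c + k" using ck by (simp add: t_def divide_le_eq)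
  then have e0_upper: "0 \<le> 2 * c - e0" by (simp add: e0_def)
  have vertex: "e0\<^sup>2 + 4 * k * w0 = 2 * (c - \<rho> * k) + (k - c)\<^sup>2 + t\<^sup>2"
    using tck unfolding e0_def w0_def power2_eq_square by algebra
  have w0_eq: "c - k + 1 - w0 * k / c = e0"
    using tck c unfolding e0_def w0_def by (simp add: field_simps)
  have up': "0 \<le> (w - w0) - (e - e0)" using up by (simp add: e0_def w0_def)
  have "c * (c - k + 1 - w * k / c) \<le> c * e" using down c by simp
  moreover have "c * (c - k + 1 - w0 * k / c) = c * e0" using w0_eq by simp
  ultimately have down': "0 \<le> c * (e - e0) + k * (w - w0)"
    using c by (simp add: algebra_simps)
  txt \<open>The gradient \<open>(2 * e0, 4 * k)\<close> of the objective at the vertex is a nonnegative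
    combination of the inward normals \<open>(-1, 1)\<close> and \<open>(c, k)\<close> of the two constraints, with multipliers
    \<open>2 * k * (2 * c - e0) / (c + k)\<close> and \<open>2 * (2 * k + e0) / (c + k)\<close>.\<close>
  have "0 \<le> k * (2 * c - e0) * ((w - w0) - (e - e0))
      + (2 * k + e0) * (c * (e - e0) + k * (w - w0))"
    using up' down' e0_lower e0_upper k by simp
  also have "\<dots> = (c + k) * (e0 * (e - e0) + 2 * k * (w - w0))"
    by (simp add: algebra_simps)
  finally have "0 \<le> e0 * (e - e0) + 2 * k * (w - w0)"
    using ck by (simp add: zero_le_mult_iff)
  moreover have "e\<^sup>2 = e0\<^sup>2 + 2 * (e0 * (e - e0)) + (e - e0)\<^sup>2"
    by (simp add: power2_eq_square algebra_simps)
  moreover have "4 * k * w = 4 * k * w0 + 2 * (2 * k * (w - w0))"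
    by (simp add: algebra_simps)
  moreover have "0 \<le> (e - e0)\<^sup>2" by simp
  ultimately have "e0\<^sup>2 + 4 * k * w0 \<le> e\<^sup>2 + 4 * k * w" by linarith
  then show ?thesis using vertex by (simp add: t_def)
qed

text \<open>Passing from k to k+1 shifts \<open>(x, y)\<close> by \<open>(1, -1)\<close>; passing to
  k-1 shifts it by \<open>(- k / c, k / c)\<close>, because \<pi>(k-1) / \<pi>(k) = k / c. So
  \<open>up\<close> and \<open>down\<close> are the two neighbour comparisons cleared of
  denominators, and dividing them by \<open>x * y\<close> makes them linear in e and w.\<close>

lemma local_max_bound:
  fixes c \<rho> k x y :: real
  assumes c: "c > 0" and k: "k \<ge> 1" and \<rho>: "\<rho> < 1" and b: "c + \<rho> > 0"
    and x: "x > 0" and y: "y > 0"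
    and up: "k * ((x + 1) * (y - 1)) \<le> (c + \<rho>) * (x * y)"
    and down: "c * ((x - k / c) * (y + k / c)) \<le> (k - 1) * (x * y)"
  shows "2 * (c - \<rho> * k) + (k - c)\<^sup>2 + ((c + \<rho> * k) / (c + k))\<^sup>2
    \<le> (k * (x + y) / (x * y))\<^sup>2"
proof -
  have P: "x * y > 0" using x y by simp
  have sq: "(k * (x + y) / (x * y))\<^sup>2 = (k * (y - x) / (x * y))\<^sup>2 + 4 * k * (k / (x * y))"
    using x y by (simp add: field_simps power2_eq_square)
  have "k * (y - x) / (x * y) \<le> (k + (c + \<rho> - k) * (x * y)) / (x * y)"
    using up P by (intro divide_right_mono) (simp_all add: algebra_simps)
  also have "\<dots> = c - k + \<rho> + k / (x * y)"
    using P x y by (simp add: add_divide_distrib)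
  finally have up': "k * (y - x) / (x * y) \<le> c - k + \<rho> + k / (x * y)" .
  have "c * ((x - k / c) * (y + k / c)) = c * (x * y) - k * (y - x) - k * k / c"
    using c by (simp add: field_simps)
  then have "(c - k + 1) * (x * y) - k * k / c \<le> k * (y - x)"
    using down by (simp add: algebra_simps)
  then have "((c - k + 1) * (x * y) - k * k / c) / (x * y) \<le> k * (y - x) / (x * y)"
    using P by (intro divide_right_mono) simp_all
  moreover have "((c - k + 1) * (x * y) - k * k / c) / (x * y) = c - k + 1 - k / (x * y) * k / c"
    using x y by (simp add: diff_divide_distrib)
  ultimately have "c - k + 1 - k / (x * y) * k / c \<le> k * (y - x) / (x * y)" by simp
  from convex_min_at_vertex[OF c k \<rho> b up' this] show ?thesis by (simp only: sq)
qed

text \<open>Points off the support have mass zero, so the tail is a probability and additivity of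
  the measure applies to it.\<close>

lemma upper_sum_eq_prob: "upper_sum p j = measure_pmf.prob p {j..}"
proof -
  have "upper_sum p j = (\<Sum>\<^sub>\<infinity>i\<in>{j..}. pmf p i)"
    unfolding upper_sum_def by (rule infsum_cong_neutral) (auto simp: set_pmf_iff)
  then show ?thesis by (simp add: measure_pmf_conv_infsetsum infsetsum_infsum pmf_abs_summable)
qed

lemma lower_sum_add_upper_sum: "lower_sum p j + upper_sum p j = 1"
proof -
  have "lower_sum p j = measure_pmf.prob p {..<j}"
    by (simp add: lower_sum_def measure_measure_pmf_finite)
  moreover have "measure_pmf.prob p ({..<j} \<union> {j..})
      = measure_pmf.prob p {..<j} + measure_pmf.prob p {j..}"
    by (intro measure_pmf.finite_measure_Union) auto
  moreover have "{..<j} \<union> {j..} = UNIV" by auto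
  ultimately show ?thesis by (simp add: upper_sum_eq_prob)
qed

lemma lower_sum_Suc: "lower_sum p (Suc j) = lower_sum p j + pmf p j"
  by (simp add: lower_sum_def)

lemma upper_sum_Suc: "upper_sum p (Suc j) = upper_sum p j - pmf p j"
  using lower_sum_add_upper_sum[of p j] lower_sum_add_upper_sum[of p "Suc j"]
  by (simp add: lower_sum_Suc)

lemma upper_sum_ge_pmf: "pmf p j \<le> upper_sum p j"
  using upper_sum_Suc[of p j] measure_nonneg[of "measure_pmf p" "{Suc j..}"]
  unfolding upper_sum_eq_prob by linarith

theorem theorem3p1:
  fixes a \<rho> :: real and N :: enat and p :: "nat pmf" and k :: nat
  assumes "a > 0" and "\<rho> < 1" and "a \<ge> \<rho>"
    and "N \<ge> 1"
    and "set_pmf p = {j. enat j \<le> N}"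
    and "\<And>j. j \<in> set_pmf p \<Longrightarrow> birth_rate p j = a + \<rho> * real j"
    and "is_arg_max (H p) (\<lambda>j. 1 \<le> j \<and> j \<in> set_pmf p) k"
    and "birth_rate p k > 0"
  shows "(a > \<rho> \<longrightarrow> H p k \<le> 1 / sqrt (2 * (a - \<rho>)))
    \<and> H p k \<le> (2 * (a - \<rho>) + ((1 - \<rho>) * real k - (a - \<rho>))\<^sup>2
          + ((a - \<rho> + 2 * \<rho> * real k) / (a - \<rho> + (1 + \<rho>) * real k))\<^sup>2) powr (- (1 / 2))"
proof -
  have k1: "1 \<le> k" and ks: "k \<in> set_pmf p"
    and max: "\<And>j. 1 \<le> j \<Longrightarrow> j \<in> set_pmf p \<Longrightarrow> H p j \<le> H p k"
    using assms(7) by (auto simp: is_arg_max_linorder)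
  obtain m where m: "k = Suc m" using k1 by (cases k) auto
  have mono: "i \<in> set_pmf p" if "i \<le> k" for i
  proof -
    have "enat i \<le> enat k" using that by simp
    then show ?thesis using ks order_trans unfolding assms(5) by blast
  qed
  define F Q q where "F = lower_sum p k" and "Q = upper_sum p k" and "q = pmf p k"
  have q: "q > 0" using ks by (simp add: q_def pmf_positive_iff)
  have q': "pmf p m > 0" using mono[of m] m by (simp add: pmf_positive_iff)
  have FQ: "F + Q = 1" by (simp add: F_def Q_def lower_sum_add_upper_sum)
  have Q: "Q > 0" using upper_sum_ge_pmf[of p k] q by (simp add: Q_def q_def)
  have F: "F > 0"
    using q' by (simp add: F_def m lower_sum_Suc) (simp add: lower_sum_def add_nonneg_pos sum_nonneg)
  define c where "c = a - \<rho> + \<rho> * real k"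
  have bm: "birth_rate p m = c"
    using assms(6)[OF mono[of m]] by (simp add: m c_def algebra_simps)
  have bk: "birth_rate p k = c + \<rho>"
    using assms(6)[OF ks] by (simp add: c_def)
  \<comment> \<open>\<open>c\<close> is the birth rate at k-1, a ratio of positive masses; this
    covers negative \<open>\<rho>\<close> too.\<close>
  have c: "c > 0" unfolding bm[symmetric] birth_rate_def using q' q by (simp add: m q_def)
  have qm: "pmf p m = real k * q / c"
    using detailed_balance[OF mono[of m]] bm c by (simp add: m q_def field_simps)
  have qk: "real (Suc k) * pmf p (Suc k) = (c + \<rho>) * q"
    using detailed_balance[OF ks] bk by (simp add: q_def)
  have b: "c + \<rho> > 0" using assms(8) bk by simp
  define x y where "x = F / q" and "y = Q / q"
  have x: "x > 0" and y: "y > 0" using F Q q by (simp_all add: x_def y_def)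
  have Fx: "F = x * q" and Qy: "Q = y * q" using q by (simp_all add: x_def y_def)
  have Hk: "H p k = x * y * q / real k"
    using q by (simp add: H_def F_def[symmetric] Q_def[symmetric] q_def[symmetric] Fx Qy)
  have up: "real k * ((x + 1) * (y - 1)) \<le> (c + \<rho>) * (x * y)"
  proof -
    \<comment> \<open>A positive birth rate at \<open>k\<close> puts \<open>Suc k\<close> in the
      support, so the maximum can be compared with it.\<close>
    have "real (Suc k) * pmf p (Suc k) > 0" using qk b q by simp
    then have "Suc k \<in> set_pmf p" by (simp add: zero_less_mult_iff pmf_positive_iff)
    then have "H p (Suc k) \<le> H p k" using max by simp
    moreover have "H p (Suc k) = (x + 1) * (y - 1) * q / (c + \<rho>)"
    proof -
      have "lower_sum p (Suc k) = (x + 1) * q" "upper_sum p (Suc k) = (y - 1) * q"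
        using Fx Qy by (simp_all add: lower_sum_Suc upper_sum_Suc F_def Q_def q_def algebra_simps)
      then show ?thesis unfolding H_def qk using q by simp
    qed
    ultimately have "(x + 1) * (y - 1) * q / (c + \<rho>) \<le> x * y * q / real k"
      using Hk by simp
    then have "q * (real k * ((x + 1) * (y - 1))) \<le> q * ((c + \<rho>) * (x * y))"
      using b k1 by (simp add: divide_le_eq le_divide_eq mult_ac)
    then show ?thesis using q by simp
  qed
  have down: "c * ((x - real k / c) * (y + real k / c)) \<le> (real k - 1) * (x * y)"
  proof (cases "m = 0")
    \<comment> \<open>For k = 1 there is no left neighbour to compare with, but then F = \<pi>(0),
      so \<open>x = k / c\<close> and both sides vanish.\<close>
    case True
    then have "F = pmf p m" by (simp add: F_def m lower_sum_def)
    then have "x = real k / c" using q qm by (simp add: x_def)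
    then show ?thesis using True by (simp add: m)
  next
    case False
    then have "H p m \<le> H p k" using max mono[of m] m by simp
    moreover have "H p m = (x - real k / c) * (y + real k / c) * q * c / (real m * real k)"
    proof -
      have "lower_sum p m = F - real k * q / c" "upper_sum p m = Q + real k * q / c"
        using qm by (simp_all add: F_def Q_def m lower_sum_Suc upper_sum_Suc)
      then have "lower_sum p m = (x - real k / c) * q" "upper_sum p m = (y + real k / c) * q"
        by (simp_all add: Fx Qy algebra_simps)
      then show ?thesis using q c False k1 by (simp add: H_def qm)
    qed
    ultimately have "(x - real k / c) * (y + real k / c) * q * c / (real m * real k)
        \<le> x * y * q / real k" using Hk by simp
    then have "(x - real k / c) * (y + real k / c) * q * c / (real m * real k) * (real m * real k)
        \<le> x * y * q / real k * (real m * real k)"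
      by (rule mult_right_mono) simp
    then have "q * (c * ((x - real k / c) * (y + real k / c))) \<le> q * (real m * (x * y))"
      using False k1 by (simp add: mult_ac)
    then show ?thesis using q by (simp add: m)
  qed
  let ?D = "2 * (a - \<rho>) + ((1 - \<rho>) * real k - (a - \<rho>))\<^sup>2
          + ((a - \<rho> + 2 * \<rho> * real k) / (a - \<rho> + (1 + \<rho>) * real k))\<^sup>2"
  have "?D = 2 * (c - \<rho> * k) + (real k - c)\<^sup>2 + ((c + \<rho> * k) / (c + k))\<^sup>2"
    by (simp add: c_def algebra_simps)
  also have "\<dots> \<le> (real k * (x + y) / (x * y))\<^sup>2"
    using local_max_bound[OF c _ assms(2) b x y up down] k1 by simp
  \<comment> \<open>Total mass one gives \<open>x + y = 1 / q\<close>, which eliminates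
    \<open>q\<close> from \<open>H p k\<close>.\<close>
  also have "real k * (x + y) / (x * y) = 1 / H p k"
  proof -
    have "(x + y) * q = 1" using FQ by (simp add: Fx Qy algebra_simps)
    then have "1 / q = x + y" using q by (simp add: field_simps)
    then show ?thesis by (simp add: Hk flip: \<open>1 / q = x + y\<close>)
  qed
  finally have D: "?D \<le> (1 / H p k)\<^sup>2" .
  have Hpos: "H p k > 0" using x y q k1 by (simp add: Hk)
  \<comment> \<open>Both parts follow from this: d is the whole bracket for (b), and the bracket
    without its squares for (a).\<close>
  have bound: "H p k \<le> 1 / sqrt d" if "0 < d" "d \<le> ?D" for d
  proof -
    have "sqrt d \<le> sqrt ((1 / H p k)\<^sup>2)" using that D by (intro real_sqrt_le_mono) linarith
    then have "sqrt d \<le> 1 / H p k" using Hpos by simp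
    then show ?thesis using Hpos that by (simp add: field_simps)
  qed
  \<comment> \<open>Positivity lets \<open>powr\<close> be read as a reciprocal square root. If
    \<open>a = \<rho>\<close>, it comes from the first square, equal to ((1 - \<rho>) k)^2.\<close>
  have Dpos: "?D > 0"
  proof (cases "a = \<rho>")
    case True
    have "((1 - \<rho>) * real k)\<^sup>2 > 0" using assms(2) k1 by simp
    then show ?thesis using True by (simp add: add_pos_nonneg)
  next
    case False
    then show ?thesis using assms(3) by (simp add: add_pos_nonneg)
  qed
  have "H p k \<le> 1 / sqrt (2 * (a - \<rho>))" if "a > \<rho>"
    using that by (intro bound) simp_all
  moreover have "H p k \<le> ?D powr (- (1 / 2))"
    using bound[OF Dpos order_refl] Dpos by (simp add: powr_minus_divide powr_half_sqrt)
  ultimately show ?thesis by blast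
qed

end
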